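(* Let $R$ be a finite commutative ring with identity. If $R$ is a local ring with maximal ideal $\mathfrak{m}$, then the unit-zero divisor graph $G_{UZ}(R)$ is a complete bipartite graph $K_{m,n}$, where $m=|\mathfrak{m}|$ and $n=|U(R)|$.
   Context: For a finite commutative ring $R$ with identity, $U(R)$ is the set of units and $Z(R)$ is the set of zero divisors, with the convention $0\in Z(R)$. The unit-zero divisor graph $G_{UZ}(R)$ is the simple undirected graph whose vertex set is the set of all elements of $R$, where two distinct vertices $u,v$ are adjacent if and only if $u+v\in U(R)$ and $uv\in Z(R)$. A commutative ring with identity is local if it has a unique maximal ideal. $K_{m,n}$ is the complete bipartite graph with nonempty parts of sizes $m$ and $n$. *)

theory Defs
  imports "HOL-Algebra.Ideal" "Graph_Theory.Kuratowski"
begin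

locale local_ring = cring +
  assumes unique_maximalideal: "\<exists>!M. maximalideal M R"

text \<open>By convention zero always counts as a zero divisor.\<close>

definition zero_divisors :: "('a, 'b) ring_scheme \<Rightarrow> 'a set" where
  "zero_divisors R = {a \<in> carrier R. a = \<zero>\<^bsub>R\<^esub> \<or>
     (\<exists>b \<in> carrier R. b \<noteq> \<zero>\<^bsub>R\<^esub> \<and> a \<otimes>\<^bsub>R\<^esub> b = \<zero>\<^bsub>R\<^esub>)}"

text \<open>Simple undirected graphs are symmetric loop-free digraphs without parallel arcs (locale
  \<^locale>\<open>graph\<close>), so an edge between \<open>u\<close> and \<open>v\<close> is the pair of arcs \<open>(u, v)\<close> and \<open>(v, u)\<close>.
  For commutative \<open>R\<close> the relation below is symmetric.\<close>

definition unit_zero_divisor_graph :: "('a, 'b) ring_scheme \<Rightarrow> ('a, 'a \<times> 'a) pre_digraph" where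
  "unit_zero_divisor_graph R = with_proj
     \<lparr>pverts = carrier R,
      parcs = {(u, v). u \<in> carrier R \<and> v \<in> carrier R \<and> u \<noteq> v \<and>
        u \<oplus>\<^bsub>R\<^esub> v \<in> Units R \<and> u \<otimes>\<^bsub>R\<^esub> v \<in> zero_divisors R}\<rparr>"

text \<open>\<^const>\<open>complete_bipartite_digraph\<close> admits empty parts; here both parts are nonempty.\<close>

definition complete_bipartite_graph :: "nat \<Rightarrow> nat \<Rightarrow> ('a, 'b) pre_digraph \<Rightarrow> bool" where
  "complete_bipartite_graph m n G \<longleftrightarrow> 0 < m \<and> 0 < n \<and> complete_bipartite_digraph m n G"

end

(* In a local ring the maximal ideal M is exactly the set of nonunits, and in a finite nontrivial
   ring the nonunits are exactly the zero divisors. Hence two elements of M have a nonunit sum,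
   two units have a product that is not a zero divisor, and an element of M and a unit are always
   adjacent. *)

theory Submission
  imports Defs
begin

text \<open>Finiteness takes the place of Zorn's lemma: there are only finitely many proper ideals,
  so some inclusion-maximal one lies above \<open>I\<close>.\<close>

lemma (in ring) finite_ideal_subset_maximalideal:
  assumes fin: "finite (carrier R)" and I: "ideal I R" and proper: "I \<noteq> carrier R"
  obtains J where "maximalideal J R" "I \<subseteq> J"
proof -
  let ?P = "{J. ideal J R \<and> J \<noteq> carrier R}"
  have "?P \<subseteq> Pow (carrier R)"
    by (auto dest: ideal.Icarr)
  then have "finite ?P"
    using fin by (meson finite_Pow_iff finite_subset)
  then obtain J where J: "J \<in> ?P" "I \<subseteq> J" and max: "\<forall>K \<in> ?P. J \<subseteq> K \<longrightarrow> J = K"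
    using I proper finite_has_maximal2[of ?P I] by blast
  have "maximalideal J R"
    by (rule maximalidealI) (use J max in auto)
  then show thesis
    using J(2) by (rule that)
qed

text \<open>The bridge from units to ideals. It serves twice: to place nonunits in a maximal ideal,
  and to see that multiplication by a nonunit is not surjective.\<close>

lemma (in cring) PIdl_eq_carrier_iff:
  assumes a: "a \<in> carrier R"
  shows "PIdl a = carrier R \<longleftrightarrow> a \<in> Units R"
proof
  assume "PIdl a = carrier R"
  then have "\<one> \<in> PIdl a"
    by simp
  then obtain x where "x \<in> carrier R" "x \<otimes> a = \<one>"
    by (auto simp: cgenideal_def)
  then show "a \<in> Units R"
    using a m_comm[of x a] unfolding Units_def by force
next
  assume "a \<in> Units R"
  then have "\<one> \<in> PIdl a"
    unfolding cgenideal_def by (auto intro!: exI[of _ "inv a"])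
  then show "PIdl a = carrier R"
    using ideal.one_imp_carrier[OF cgenideal_ideal[OF a]] by blast
qed

lemma (in ideal) Units_disjoint:
  assumes "I \<noteq> carrier R"
  shows "I \<inter> Units R = {}"
proof (rule ccontr)
  assume "I \<inter> Units R \<noteq> {}"
  then obtain a where a: "a \<in> I" "a \<in> Units R"
    by blast
  then have "inv a \<otimes> a \<in> I"
    by (intro I_l_closed) auto
  with a(2) show False
    using one_imp_carrier assms by simp
qed

text \<open>A nonunit generates a proper ideal, which lies in some maximal ideal, and by uniqueness
  this is \<open>M\<close>. Conversely, a proper ideal contains no unit.\<close>

lemma (in local_ring) finite_maximalideal_eq_nonunits:
  assumes fin: "finite (carrier R)" and M: "maximalideal M R"
  shows "M = carrier R - Units R"
proof
  interpret M: maximalideal M R by fact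
  show "M \<subseteq> carrier R - Units R"
    using M.Units_disjoint M.I_notcarr M.Icarr by blast
  show "carrier R - Units R \<subseteq> M"
  proof
    fix a assume "a \<in> carrier R - Units R"
    then have a: "a \<in> carrier R" and "PIdl a \<noteq> carrier R"
      using PIdl_eq_carrier_iff by auto
    then obtain J where "maximalideal J R" "PIdl a \<subseteq> J"
      using finite_ideal_subset_maximalideal[OF fin cgenideal_ideal] by blast
    then show "a \<in> M"
      using unique_maximalideal M cgenideal_self[OF a] by blast
  qed
qed

text \<open>Units cancel, so they annihilate only zero. Multiplication by a nonunit is not
  surjective, hence on a finite carrier not injective, and a collision yields a nonzero annihilated
  difference.\<close>

lemma (in cring) finite_zero_divisors_eq_nonunits:
  assumes fin: "finite (carrier R)" and nontrivial: "\<one> \<noteq> \<zero>"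
  shows "zero_divisors R = carrier R - Units R"
proof
  show "zero_divisors R \<subseteq> carrier R - Units R"
  proof
    fix a assume a: "a \<in> zero_divisors R"
    \<comment> \<open>If \<open>a\<close> is zero only by the convention, \<open>\<one>\<close>
      serves as the witness \<open>b\<close>; this is where nontriviality enters.\<close>
    then have "a \<in> carrier R" and "\<exists>b \<in> carrier R. b \<noteq> \<zero> \<and> a \<otimes> b = \<zero>"
      using nontrivial unfolding zero_divisors_def by force+
    moreover have "b = \<zero>" if "a \<in> Units R" "b \<in> carrier R" "a \<otimes> b = \<zero>" for b
      using Units_l_cancel[OF that(1,2) zero_closed] that by auto
    ultimately show "a \<in> carrier R - Units R"
      by blast
  qed
  show "carrier R - Units R \<subseteq> zero_divisors R"
  proof
    fix a assume "a \<in> carrier R - Units R"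
    then have a: "a \<in> carrier R" and "a \<notin> Units R"
      by auto
    \<comment> \<open>The range of multiplication by \<open>a\<close> is exactly
      \<open>PIdl a\<close>.\<close>
    then have "(\<lambda>x. x \<otimes> a) ` carrier R \<noteq> carrier R"
      using PIdl_eq_carrier_iff[OF a] by (simp add: cgenideal_def image_def Setcompr_eq_image)
    moreover have "(\<lambda>x. x \<otimes> a) ` carrier R \<subseteq> carrier R"
      using a by auto
    ultimately have "\<not> inj_on (\<lambda>x. x \<otimes> a) (carrier R)"
      using endo_inj_surj[OF fin] by blast
    then obtain x y where xy: "x \<in> carrier R" "y \<in> carrier R" "x \<noteq> y" "x \<otimes> a = y \<otimes> a"
      by (auto simp: inj_on_def)
    have "a \<otimes> (x \<ominus> y) = x \<otimes> a \<ominus> y \<otimes> a"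
      using a xy(1,2) by algebra
    then have "a \<otimes> (x \<ominus> y) = \<zero>"
      using a xy(2,4) by (simp add: a_minus_def r_neg)
    \<comment> \<open>A zero difference would turn this identity into \<open>x = y\<close>.\<close>
    moreover have "x = (x \<ominus> y) \<oplus> y"
      using xy(1,2) by algebra
    then have "x \<ominus> y \<noteq> \<zero>"
      using xy(2,3) by auto
    ultimately show "a \<in> zero_divisors R"
      using a xy(1,2) unfolding zero_divisors_def by blast
  qed
qed

text \<open>Each element is either in \<open>M\<close> or a unit, which leaves four cases. In the
  mixed ones \<open>u \<noteq> v\<close> follows from disjointness.\<close>

lemma (in local_ring) finite_unit_zero_divisor_adjacent_iff:
  assumes fin: "finite (carrier R)" and M: "maximalideal M R"
    and u: "u \<in> carrier R" and v: "v \<in> carrier R"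
  shows "u \<noteq> v \<and> u \<oplus> v \<in> Units R \<and> u \<otimes> v \<in> zero_divisors R \<longleftrightarrow>
    u \<in> M \<and> v \<in> Units R \<or> u \<in> Units R \<and> v \<in> M"
proof -
  interpret M: maximalideal M R by fact
  have M_eq: "M = carrier R - Units R"
    using fin M by (rule finite_maximalideal_eq_nonunits)
  \<comment> \<open>Otherwise \<open>\<one>\<close> would lie in \<open>M\<close>, making it the
    whole ring.\<close>
  have "\<one> \<noteq> \<zero>"
    using M.one_imp_carrier M.I_notcarr M.zero_closed by metis
  then have Z_eq: "zero_divisors R = M"
    using finite_zero_divisors_eq_nonunits[OF fin] M_eq by simp
  have carrier_eq: "carrier R = M \<union> Units R" and disj: "M \<inter> Units R = {}"
    using M_eq by auto
  have unit_sum: "x \<oplus> u \<in> Units R" if x: "x \<in> M" and u: "u \<in> Units R" for x u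
  proof (rule ccontr)
    have carr: "x \<in> carrier R" "u \<in> carrier R"
      using x u by (auto simp: carrier_eq)
    assume "x \<oplus> u \<notin> Units R"
    then have "x \<oplus> u \<in> M"
      using carr M_eq by simp
    \<comment> \<open>Subtracting \<open>x\<close> inside the ideal recovers
      \<open>u\<close>.\<close>
    then have "\<ominus> x \<oplus> (x \<oplus> u) \<in> M"
      using M.a_closed[OF M.a_inv_closed[OF x]] by blast
    then have "u \<in> M"
      using carr by (simp add: r_neg1)
    with u disj show False
      by blast
  qed
  consider "u \<in> M" "v \<in> M" | "u \<in> M" "v \<in> Units R" | "u \<in> Units R" "v \<in> M"
    | "u \<in> Units R" "v \<in> Units R"
    using u v carrier_eq by blast
  then show ?thesis
  proof cases
    case 1
    then have "u \<oplus> v \<in> M"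
      by (rule M.a_closed)
    with 1 disj show ?thesis by blast
  next
    case 2
    then have "u \<otimes> v \<in> M"
      using v by (intro M.I_r_closed)
    with 2 disj unit_sum show ?thesis
      by (auto simp: Z_eq)
  next
    case 3
    then have "u \<otimes> v \<in> M" and "u \<oplus> v \<in> Units R"
      using u v unit_sum[of v u] by (auto intro: M.I_l_closed simp: a_comm)
    with 3 disj show ?thesis
      by (auto simp: Z_eq)
  next
    case 4
    then have "u \<otimes> v \<in> Units R"
      by (rule Units_m_closed)
    with 4 disj show ?thesis
      by (auto simp: Z_eq)
  qed
qed

theorem theorem3p5:
  fixes R :: "('a, 'b) ring_scheme" and M :: "'a set"
  assumes "cring R"
    and "finite (carrier R)"
    and "local_ring R"
    and "maximalideal M R"
  shows "complete_bipartite_graph (card M) (card (Units R)) (unit_zero_divisor_graph R)"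
proof -
  interpret local_ring R by fact
  interpret M: maximalideal M R by fact
  note fin = \<open>finite (carrier R)\<close>
  have M_eq: "M = carrier R - Units R"
    using fin assms(4) by (rule finite_maximalideal_eq_nonunits)
  then have carrier_eq: "carrier R = M \<union> Units R" and disj: "M \<inter> Units R = {}"
    by auto
  \<comment> \<open>Both orientations of every edge between the parts appear, as a symmetric digraph
    requires.\<close>
  have "{(u, v). u \<in> carrier R \<and> v \<in> carrier R \<and> u \<noteq> v \<and>
      u \<oplus>\<^bsub>R\<^esub> v \<in> Units R \<and> u \<otimes>\<^bsub>R\<^esub> v \<in> zero_divisors R} = M \<times> Units R \<union> Units R \<times> M"
    using finite_unit_zero_divisor_adjacent_iff[OF fin assms(4)] carrier_eq by blast
  then have "complete_bipartite_digraph (card M) (card (Units R)) (unit_zero_divisor_graph R)"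
    unfolding unit_zero_divisor_graph_def complete_bipartite_digraph_pair_def
    using fin carrier_eq disj by auto
  \<comment> \<open>The parts contain \<open>\<zero>\<close> and \<open>\<one>\<close>
    respectively.\<close>
  moreover have "0 < card M" and "0 < card (Units R)"
    using fin carrier_eq M.zero_closed Units_one_closed
    by (metis card_gt_0_iff empty_iff finite_Un)+
  ultimately show ?thesis
    by (simp add: complete_bipartite_graph_def)
qed

end
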